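(* Let $F$ be a field with $\operatorname{char} F = 0$. Let $n\ge 1$ and $t\ge 1$ be integers and let $q_1,\dots,q_n \in \{{\tt A},{\tt S}\}$. Then the sequence $q_1 q_2 \cdots q_{n}\underbrace{{\tt N}\cdots{\tt N}}_{t}$ (consisting of $q_1,\dots,q_n$ followed by $t$ copies of ${\tt N}$) is the qpr-sequence of some symmetric matrix in $F^{(n+t)\times(n+t)}$.
   Context: For an $m\times m$ matrix $B$ and $\alpha,\beta\subseteq\{1,\dots,m\}$, $B[\alpha,\beta]$ denotes the submatrix with rows indexed by $\alpha$ and columns indexed by $\beta$. $B[\alpha,\beta]$ is a quasi-principal submatrix if $|\alpha|=|\beta|$ and $|\alpha|-1\le|\alpha\cap\beta|\le|\alpha|$; its determinant is then a quasi-principal minor of order $|\alpha|$. The quasi principal rank characteristic sequence (qpr-sequence) of a symmetric $B\in F^{m\times m}$ is $\operatorname{qpr}(B)=q_1q_2\cdots q_m$, where $q_k={\tt A}$ if all quasi-principal minors of order $k$ are nonzero, $q_k={\tt S}$ if some but not all are nonzero, and $q_k={\tt N}$ if all are zero. *)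

theory Defs
  imports "Jordan_Normal_Form.Determinant" "Jordan_Normal_Form.DL_Submatrix"
begin

(* Rows and columns of a matrix are indexed from 0, so index sets are subsets of {0..<m}. *)

definition quasi_principal :: "nat \<Rightarrow> nat set \<Rightarrow> nat set \<Rightarrow> bool" where
  "quasi_principal m \<alpha> \<beta> \<longleftrightarrow>
     \<alpha> \<subseteq> {0..<m} \<and> \<beta> \<subseteq> {0..<m} \<and> card \<alpha> = card \<beta> \<and>
     card \<alpha> - 1 \<le> card (\<alpha> \<inter> \<beta>) \<and> card (\<alpha> \<inter> \<beta>) \<le> card \<alpha>"

definition qp_minors :: "'a::field mat \<Rightarrow> nat \<Rightarrow> 'a set" where
  "qp_minors B k =
     {det (submatrix B \<alpha> \<beta>) | \<alpha> \<beta>. quasi_principal (dim_row B) \<alpha> \<beta> \<and> card \<alpha> = k}"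

datatype qpr_letter = A | S | N

(* For 1 \<le> k \<le> dim_row B the set of minors is nonempty, so the cases A and N exclude each other. *)
definition qpr_entry :: "'a::field mat \<Rightarrow> nat \<Rightarrow> qpr_letter" where
  "qpr_entry B k =
     (if \<forall>d \<in> qp_minors B k. d \<noteq> 0 then A
      else if \<exists>d \<in> qp_minors B k. d \<noteq> 0 then S
      else N)"

(* q_k is stored at position k - 1 of the list. *)
definition qpr :: "'a::field mat \<Rightarrow> qpr_letter list" where
  "qpr B = map (qpr_entry B) [1..<Suc (dim_row B)]"

end

theory Submission
  imports Defs "Jordan_Normal_Form.Char_Poly"
begin

text \<open>Put \<open>m = n + t\<close> and \<open>B = (\<Sum>i<n. d i \<cdot> M\<^sub>i\<^sup>T M\<^sub>i)\<close> with row vectors \<open>M\<^sub>i\<close> of length \<open>m\<close>, so that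
  minors of order above \<open>n\<close> vanish. Outside column \<open>n\<close>, \<open>M\<close> has the entries
  \<open>M i j = j (j - 1) \<cdots> (j - i + 1)\<close>: it is upper triangular and, by interpolation, the minors on its
  first \<open>k\<close> rows are nonzero. In column \<open>n\<close> the entry in row \<open>k - 1\<close> is 0 if the \<open>k\<close>-th letter is
  \<open>S\<close>, and generic otherwise. Triangularity makes the minor of \<open>B\<close> on rows \<open>{0..<k}\<close> and columns
  \<open>{0..<k - 1} \<union> {n}\<close> vanish in the first case; if the letter is \<open>A\<close>, all minors of \<open>M\<close> on
  its first \<open>k\<close> rows are nonzero. Choosing the weights \<open>d i\<close> one after the other, each outside a
  finite set of roots, carries this nonvanishing over to \<open>B\<close>: the minors of order \<open>k\<close> are nonzero
  after \<open>k\<close> summands, and are polynomials in each subsequent weight.\<close>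

section \<open>Determinants of weighted sums of rank-one matrices\<close>

lemma det_mat_nonzeroI:
  fixes F :: "nat \<Rightarrow> nat \<Rightarrow> 'a::field"
  assumes "\<And>c. (\<And>a. a < k \<Longrightarrow> (\<Sum>i<k. F a i * c i) = 0) \<Longrightarrow> (\<forall>i<k. c i = 0)"
  shows "det (mat k k (\<lambda>(a, i). F a i)) \<noteq> 0"
proof
  let ?X = "mat k k (\<lambda>(a, i). F a i)"
  assume "det ?X = 0"
  then obtain v where v: "v \<in> carrier_vec k" "v \<noteq> 0\<^sub>v k" "?X *\<^sub>v v = 0\<^sub>v k"
    using det_0_iff_vec_prod_zero_field[of ?X k] by auto
  have "(\<Sum>i<k. F a i * v $ i) = 0" if "a < k" for a
  proof -
    have "(?X *\<^sub>v v) $ a = (\<Sum>i<k. F a i * v $ i)"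
      using that v(1) by (simp add: scalar_prod_def atLeast0LessThan)
    then show ?thesis using v(3) that by simp
  qed
  then have "\<forall>i<k. v $ i = 0" by (rule assms)
  then have "v = 0\<^sub>v k" using v(1) by (intro eq_vecI) auto
  then show False using v(2) by simp
qed

text \<open>With at most \<open>k\<close> summands, zero columns pad the left factor, so that both
  factors are square and \<open>det_mult\<close> applies. Rows of the right factor from
  \<open>r\<close> on meet only zero columns, so their values are harmless.\<close>

lemma det_sum_rank_one_factor:
  fixes d :: "nat \<Rightarrow> 'a::comm_ring_1"
  assumes "r \<le> k"
  shows "det (mat k k (\<lambda>(a, b). \<Sum>i<r. d i * f i a * g i b)) =
    det (mat k k (\<lambda>(a, i). if i < r then d i * f i a else 0)) * det (mat k k (\<lambda>(i, b). g i b))"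
proof -
  let ?X = "mat k k (\<lambda>(a, i). if i < r then d i * f i a else 0)"
  let ?Y = "mat k k (\<lambda>(i, b). g i b)"
  have "mat k k (\<lambda>(a, b). \<Sum>i<r. d i * f i a * g i b) = ?X * ?Y"
  proof (rule eq_matI)
    fix a b assume "a < dim_row (?X * ?Y)" "b < dim_col (?X * ?Y)"
    then have ab: "a < k" "b < k" by auto
    have "(?X * ?Y) $$ (a, b) = (\<Sum>i<k. if i < r then d i * f i a * g i b else 0)"
      using ab by (auto simp: scalar_prod_def atLeast0LessThan intro!: sum.cong)
    also have "\<dots> = (\<Sum>i<r. d i * f i a * g i b)"
      using assms by (intro sum.mono_neutral_cong_right) auto
    finally show "mat k k (\<lambda>(a, b). \<Sum>i<r. d i * f i a * g i b) $$ (a, b) = (?X * ?Y) $$ (a, b)"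
      using ab by simp
  qed auto
  then show ?thesis using det_mult[of ?X k ?Y] by simp
qed

text \<open>Column \<open>r\<close> of the padded left factor is zero, so a unit vector lies in its
  kernel.\<close>

lemma det_sum_rank_one_eq_0:
  fixes d :: "nat \<Rightarrow> 'a::field"
  assumes "r < k"
  shows "det (mat k k (\<lambda>(a, b). \<Sum>i<r. d i * f i a * g i b)) = 0"
proof -
  let ?X = "mat k k (\<lambda>(a, i). if i < r then d i * f i a else 0)"
  have "?X *\<^sub>v unit_vec k r = 0\<^sub>v k"
    using assms by (intro eq_vecI) (auto simp: scalar_prod_def unit_vec_def intro!: sum.neutral)
  then have "det ?X = 0"
    using assms det_0_iff_vec_prod_zero_field[of ?X k]
    by (auto intro!: exI[of _ "unit_vec k r"])
  then show ?thesis using assms by (simp add: det_sum_rank_one_factor)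
qed

text \<open>For finite \<alpha> with \<open>card \<alpha> = k\<close> this says that the minor of
  \<open>M\<close> on its first \<open>k\<close> rows and the columns in \<alpha> is nonzero; linear
  relations express it without enumerating \<alpha> by \<open>pick\<close>.\<close>

definition rows_independent_on :: "(nat \<Rightarrow> nat \<Rightarrow> 'a::field) \<Rightarrow> nat \<Rightarrow> nat set \<Rightarrow> bool" where
  "rows_independent_on M k \<alpha> \<longleftrightarrow>
     (\<forall>c. (\<forall>a\<in>\<alpha>. (\<Sum>i<k. c i * M i a) = 0) \<longrightarrow> (\<forall>i<k. c i = 0))"

lemma rows_independent_onD:
  assumes "rows_independent_on M k \<alpha>" and "\<And>a. a \<in> \<alpha> \<Longrightarrow> (\<Sum>i<k. c i * M i a) = 0" and "i < k"
  shows "c i = 0"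
  using assms unfolding rows_independent_on_def by blast

lemma pick_surj:
  assumes "finite \<alpha>" and "a \<in> \<alpha>"
  obtains j where "j < card \<alpha>" and "pick \<alpha> j = a"
proof
  show "pick \<alpha> (card {b\<in>\<alpha>. b < a}) = a"
    using assms(2) by (rule pick_card_in_set)
  show "card {b\<in>\<alpha>. b < a} < card \<alpha>"
    using assms by (intro psubset_card_mono) auto
qed

text \<open>With exactly \<open>k\<close> summands nothing is padded: both factors are invertible by
  independence, the left one also because the weights are nonzero.\<close>

lemma det_sum_rank_one_nonzero:
  fixes d :: "nat \<Rightarrow> 'a::field"
  assumes "finite \<alpha>" "finite \<beta>" "card \<alpha> = k" "card \<beta> = k"
    and "rows_independent_on M k \<alpha>" "rows_independent_on M k \<beta>"
    and "\<And>i. i < k \<Longrightarrow> d i \<noteq> 0"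
  shows "det (mat k k (\<lambda>(a, b). \<Sum>i<k. d i * M i (pick \<alpha> a) * M i (pick \<beta> b))) \<noteq> 0"
proof -
  have "det (mat k k (\<lambda>(a, i). if i < k then d i * M i (pick \<alpha> a) else 0)) \<noteq> 0"
  proof (rule det_mat_nonzeroI, intro allI impI)
    fix c i
    assume 0: "\<And>a. a < k \<Longrightarrow> (\<Sum>i<k. (if i < k then d i * M i (pick \<alpha> a) else 0) * c i) = 0"
      and i: "i < k"
    have "(\<Sum>i<k. (c i * d i) * M i a) = 0" if a: "a \<in> \<alpha>" for a
    proof -
      obtain j where j: "j < k" "pick \<alpha> j = a" using pick_surj[OF assms(1) a] assms(3) by metis
      have "(\<Sum>i<k. (c i * d i) * M i a) = (\<Sum>i<k. (if i < k then d i * M i (pick \<alpha> j) else 0) * c i)"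
        using j by (intro sum.cong) auto
      then show ?thesis using 0[OF j(1)] by simp
    qed
    then have "c i * d i = 0" using rows_independent_onD[OF assms(5) _ i, of "\<lambda>i. c i * d i"] by blast
    then show "c i = 0" using assms(7)[OF i] by simp
  qed
  moreover have "det (mat k k (\<lambda>(i, b). M i (pick \<beta> b))) \<noteq> 0"
  proof -
    have "det (mat k k (\<lambda>(b, i). M i (pick \<beta> b))) \<noteq> 0"
    proof (rule det_mat_nonzeroI, intro allI impI)
      fix c i
      assume 0: "\<And>b. b < k \<Longrightarrow> (\<Sum>i<k. M i (pick \<beta> b) * c i) = 0" and i: "i < k"
      have "(\<Sum>i<k. c i * M i b) = 0" if b: "b \<in> \<beta>" for b
      proof -
        obtain j where j: "j < k" "pick \<beta> j = b" using pick_surj[OF assms(2) b] assms(4) by metis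
        then show ?thesis using 0[OF j(1)] by (simp add: mult.commute)
      qed
      then show "c i = 0" using rows_independent_onD[OF assms(6) _ i] by blast
    qed
    moreover have "mat k k (\<lambda>(i, b). M i (pick \<beta> b)) = transpose_mat (mat k k (\<lambda>(b, i). M i (pick \<beta> b)))"
      by (intro eq_matI) auto
    ultimately show ?thesis using det_transpose[of "mat k k (\<lambda>(b, i). M i (pick \<beta> b))" k] by simp
  qed
  ultimately show ?thesis by (subst det_sum_rank_one_factor) auto
qed

section \<open>Generic choice of the weights\<close>

lemma sum_updated_last:
  fixes d :: "nat \<Rightarrow> 'a::comm_ring_1"
  shows "(\<Sum>i<Suc r. (d(r := y)) i * f i * g i) = (\<Sum>i<r. d i * f i * g i) + y * (f r * g r)"
proof -
  have "(\<Sum>i<r. (d(r := y)) i * f i * g i) = (\<Sum>i<r. d i * f i * g i)"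
    by (intro sum.cong) auto
  then show ?thesis by (simp add: mult.assoc)
qed

text \<open>The last weight has two tasks: minors of order \<open>r\<close> only need it to be
  nonzero, while smaller minors must survive the new summand, which excludes finitely many
  values.\<close>

lemma ex_weights_minors_nonzero:
  fixes M :: "nat \<Rightarrow> nat \<Rightarrow> 'a::field_char_0"
  shows "\<exists>d. (\<forall>i<r. d i \<noteq> 0) \<and>
    (\<forall>\<alpha> \<beta>. card \<alpha> \<le> r \<longrightarrow> \<alpha> \<subseteq> {0..<m} \<longrightarrow> \<beta> \<subseteq> {0..<m} \<longrightarrow> card \<beta> = card \<alpha> \<longrightarrow>
      rows_independent_on M (card \<alpha>) \<alpha> \<longrightarrow> rows_independent_on M (card \<alpha>) \<beta> \<longrightarrow>
      det (mat (card \<alpha>) (card \<alpha>)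
        (\<lambda>(a, b). \<Sum>i<r. d i * M i (pick \<alpha> a) * M i (pick \<beta> b))) \<noteq> 0)"
proof (induction r)
  case 0
  show ?case by (auto simp: det_dim_zero)
next
  case (Suc r)
  define V where "V d r \<alpha> \<beta> =
    mat (card \<alpha>) (card \<alpha>) (\<lambda>(a, b). \<Sum>i<r. d i * M i (pick \<alpha> a) * M i (pick \<beta> b))"
    for d :: "nat \<Rightarrow> 'a" and r and \<alpha> \<beta> :: "nat set"
  from Suc obtain d where d0: "\<And>i. i < r \<Longrightarrow> d i \<noteq> 0"
    and IH: "\<And>\<alpha> \<beta>. card \<alpha> \<le> r \<Longrightarrow> \<alpha> \<subseteq> {0..<m} \<Longrightarrow> \<beta> \<subseteq> {0..<m} \<Longrightarrow> card \<beta> = card \<alpha> \<Longrightarrow>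
      rows_independent_on M (card \<alpha>) \<alpha> \<Longrightarrow> rows_independent_on M (card \<alpha>) \<beta> \<Longrightarrow> det (V d r \<alpha> \<beta>) \<noteq> 0"
    unfolding V_def by blast
  define P where "P \<alpha> \<beta> = det (mat (card \<alpha>) (card \<alpha>) (\<lambda>(a, b).
    [:\<Sum>i<r. d i * M i (pick \<alpha> a) * M i (pick \<beta> b), M r (pick \<alpha> a) * M r (pick \<beta> b):]))"
    for \<alpha> \<beta> :: "nat set"
  have P: "poly (P \<alpha> \<beta>) y = det (V (d(r := y)) (Suc r) \<alpha> \<beta>)" for \<alpha> \<beta> y
    unfolding P_def V_def
    by (rule poly_det_cong[of _ "card \<alpha>"]) (auto simp only: sum_updated_last mat_carrier, auto)
  \<comment> \<open>Weight 0 drops the new summand, so by the induction hypothesis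
    \<open>P \<alpha> \<beta>\<close> is not the zero polynomial when the order is at most
    \<open>r\<close> and both column sets are independent.\<close>
  have P0: "poly (P \<alpha> \<beta>) 0 = det (V d r \<alpha> \<beta>)" for \<alpha> \<beta>
    unfolding P_def V_def by (rule poly_det_cong[of _ "card \<alpha>"]) auto
  let ?I = "{(\<alpha>, \<beta>). \<alpha> \<subseteq> {0..<m} \<and> \<beta> \<subseteq> {0..<m} \<and> P \<alpha> \<beta> \<noteq> 0}"
  have "?I \<subseteq> Pow {0..<m} \<times> Pow {0..<m}" by auto
  then have "finite ?I" by (rule finite_subset) simp
  then have "finite ({0} \<union> (\<Union>(\<alpha>, \<beta>)\<in>?I. {y. poly (P \<alpha> \<beta>) y = 0}))" (is "finite ?bad")
    by (auto intro!: poly_roots_finite)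
  from ex_new_if_finite[OF infinite_UNIV_char_0 this] obtain y where "y \<notin> ?bad" ..
  then have y0: "y \<noteq> 0" and y: "\<And>\<alpha> \<beta>. (\<alpha>, \<beta>) \<in> ?I \<Longrightarrow> poly (P \<alpha> \<beta>) y \<noteq> 0"
    by auto
  have "det (V (d(r := y)) (Suc r) \<alpha> \<beta>) \<noteq> 0"
    if le: "card \<alpha> \<le> Suc r" and sub: "\<alpha> \<subseteq> {0..<m}" "\<beta> \<subseteq> {0..<m}" and card: "card \<beta> = card \<alpha>"
      and ind: "rows_independent_on M (card \<alpha>) \<alpha>" "rows_independent_on M (card \<alpha>) \<beta>" for \<alpha> \<beta>
  proof (cases "card \<alpha> = Suc r")
    case True
    have fin: "finite \<alpha>" "finite \<beta>" using sub finite_subset by blast+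
    have "(d(r := y)) i \<noteq> 0" if "i < Suc r" for i using that d0 y0 by auto
    then show ?thesis
      using det_sum_rank_one_nonzero[OF fin refl card ind, of "d(r := y)"] True by (simp add: V_def)
  next
    case False
    then have "poly (P \<alpha> \<beta>) 0 \<noteq> 0" using IH le sub card ind by (simp add: P0)
    then have "P \<alpha> \<beta> \<noteq> 0" by auto
    then show ?thesis using y[of \<alpha> \<beta>] sub by (simp add: P)
  qed
  moreover have "\<forall>i<Suc r. (d(r := y)) i \<noteq> 0" using d0 y0 by (auto simp: less_Suc_eq)
  ultimately show ?case unfolding V_def
    by (intro exI[of _ "d(r := y)"] conjI) (assumption, blast)
qed

section \<open>Interpolation and the triangular array\<close>

definition falling :: "nat \<Rightarrow> nat \<Rightarrow> 'a::field_char_0" where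
  "falling i j = (\<Prod>l<i. of_nat j - of_nat l)"

lemma falling_eq_0: "j < i \<Longrightarrow> falling i j = 0"
  by (auto simp: falling_def)

lemma falling_self_nonzero: "falling i i \<noteq> 0"
  by (auto simp: falling_def)

text \<open>A combination of the rows evaluates a polynomial of degree below \<open>k\<close>,
  written in the Newton basis. In characteristic 0 the elements of \<alpha> are at least
  \<open>k\<close> distinct roots, so this polynomial is zero.\<close>

lemma rows_independent_on_falling:
  assumes "finite \<alpha>" "k \<le> card \<alpha>"
  shows "rows_independent_on (falling :: nat \<Rightarrow> nat \<Rightarrow> 'a::field_char_0) k \<alpha>"
  unfolding rows_independent_on_def
proof (intro allI impI)
  fix c :: "nat \<Rightarrow> 'a" and i
  assume 0: "\<forall>a\<in>\<alpha>. (\<Sum>i<k. c i * falling i a) = 0" and "i < k"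
  define p where "p = (\<Sum>i<k. smult (c i) (\<Prod>l<i. [:- of_nat l, 1:]))"
  have p: "poly p (of_nat a) = (\<Sum>i<k. c i * falling i a)" for a
    by (simp add: p_def poly_sum poly_prod falling_def)
  have "degree p < k" unfolding p_def
  proof (rule degree_sum_less)
    fix j assume "j \<in> {..<k}"
    have "degree (\<Prod>l<j. [:- of_nat l, 1 :: 'a:]) = j"
      by (subst degree_prod_eq_sum_degree) auto
    then show "degree (smult (c j) (\<Prod>l<j. [:- of_nat l, 1:])) < k"
      using \<open>j \<in> {..<k}\<close> by (auto intro: le_less_trans[OF degree_smult_le])
  qed (use \<open>i < k\<close> in auto)
  moreover have "card (of_nat ` \<alpha> :: 'a set) = card \<alpha>"
    by (intro card_image) (auto simp: inj_on_def)
  ultimately have "p = 0"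
    using 0 assms(2) by (intro poly_eqI_degree[of "of_nat ` \<alpha>"]) (auto simp: p)
  then have eval: "(\<Sum>i<k. c i * falling i a) = 0" for a using p[of a] by simp
  \<comment> \<open>Evaluation at \<open>i\<close> isolates \<open>c i\<close>: smaller indices are
    gone by induction, larger ones by \<open>falling_eq_0\<close>, and the remaining factor
    \<open>falling i i\<close> is the factorial of \<open>i\<close>.\<close>
  show "c i = 0" using \<open>i < k\<close>
  proof (induction i rule: less_induct)
    case (less i)
    have "(\<Sum>l<k. c l * falling l i) = (\<Sum>l\<in>{i}. c l * falling l i)"
      using less falling_eq_0[of i, where 'a = 'a]
      by (intro sum.mono_neutral_right) (auto, metis linorder_neqE_nat)
    then show ?case using eval[of i] falling_self_nonzero[of i, where 'a = 'a] by simp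
  qed
qed

text \<open>On the rows below \<open>Suc k\<close>, a combination with leading coefficient 1 vanishing on a given set of
  \<open>k\<close> columns is unique, so each entry of column \<open>n\<close> indexed outside \<open>Q\<close> has only finitely many
  forbidden values once the earlier entries are fixed.\<close>

lemma ex_triangular_array_prescribed_column:
  fixes Q :: "nat set" and n m :: nat
  shows "\<exists>M :: nat \<Rightarrow> nat \<Rightarrow> 'a::field_char_0.
    (\<forall>i j. j < i \<longrightarrow> j \<noteq> n \<longrightarrow> M i j = 0) \<and> (\<forall>i\<in>Q. M i n = 0) \<and>
    (\<forall>\<alpha>\<subseteq>{0..<m}. n \<notin> \<alpha> \<or> card \<alpha> - 1 \<notin> Q \<longrightarrow> rows_independent_on M (card \<alpha>) \<alpha>)"
proof -
  define monic_zero where "monic_zero \<gamma> c \<longleftrightarrow>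
      c (card \<gamma>) = 1 \<and> (\<forall>a\<in>\<gamma>. (\<Sum>i<Suc (card \<gamma>). c i * falling i a) = 0)"
    for \<gamma> :: "nat set" and c :: "nat \<Rightarrow> 'a"
  \<comment> \<open>Used only for \<gamma> that admit such a \<open>c\<close>; for other \<gamma>
    the arbitrary value merely adds a forbidden entry below.\<close>
  define g where "g \<gamma> = (SOME c. monic_zero \<gamma> c)" for \<gamma>
  have unique: "c i = g \<gamma> i" if "finite \<gamma>" "monic_zero \<gamma> c" "i < card \<gamma>" for \<gamma> c i
  proof -
    have g: "monic_zero \<gamma> (g \<gamma>)" unfolding g_def using that(2) by (rule someI[of "monic_zero \<gamma>"])
    have "(\<Sum>i<card \<gamma>. (c i - g \<gamma> i) * falling i a) = 0" if a: "a \<in> \<gamma>" for a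
    proof -
      have "(\<Sum>i<card \<gamma>. c i * falling i a) + falling (card \<gamma>) a = 0"
        and "(\<Sum>i<card \<gamma>. g \<gamma> i * falling i a) + falling (card \<gamma>) a = 0"
        using a \<open>monic_zero \<gamma> c\<close> g by (auto simp: monic_zero_def)
      then show ?thesis
        by (simp add: left_diff_distrib sum_subtractf eq_neg_iff_add_eq_0[symmetric])
    qed
    then have "c i - g \<gamma> i = 0"
      using rows_independent_onD[OF rows_independent_on_falling[OF that(1) order_refl] _ that(3),
          of "\<lambda>i. c i - g \<gamma> i"] by blast
    then show ?thesis by simp
  qed
  \<comment> \<open>The entries of column \<open>n\<close> are chosen recursively: the values
    forbidden for \<open>v i\<close> involve only \<open>v l\<close> with \<open>l < i\<close>, one
    value for each \<gamma>.\<close>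
  have "\<exists>v. \<forall>i. if i \<in> Q then v i = 0
      else v i \<notin> (\<lambda>\<gamma>. - (\<Sum>l<i. g \<gamma> l * v l)) ` Pow {0..<m}"
  proof (rule dependent_wellorder_choice)
    fix r :: 'a and v w :: "nat \<Rightarrow> 'a" and i
    assume "\<And>l. l < i \<Longrightarrow> v l = w l"
    then have "(\<Sum>l<i. g \<gamma> l * v l) = (\<Sum>l<i. g \<gamma> l * w l)" for \<gamma>
      by (intro sum.cong) auto
    then show "(if i \<in> Q then r = 0 else r \<notin> (\<lambda>\<gamma>. - (\<Sum>l<i. g \<gamma> l * v l)) ` Pow {0..<m}) =
      (if i \<in> Q then r = 0 else r \<notin> (\<lambda>\<gamma>. - (\<Sum>l<i. g \<gamma> l * w l)) ` Pow {0..<m})"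
      by simp
  next
    fix i and v :: "nat \<Rightarrow> 'a"
    have "finite ((\<lambda>\<gamma>. - (\<Sum>l<i. g \<gamma> l * v l)) ` Pow {0..<m})" by simp
    from ex_new_if_finite[OF infinite_UNIV_char_0 this]
    show "\<exists>r. if i \<in> Q then r = 0 else r \<notin> (\<lambda>\<gamma>. - (\<Sum>l<i. g \<gamma> l * v l)) ` Pow {0..<m}"
      by (cases "i \<in> Q") simp_all
  qed
  then obtain v where v: "\<And>i. if i \<in> Q then v i = 0
      else v i \<notin> (\<lambda>\<gamma>. - (\<Sum>l<i. g \<gamma> l * v l)) ` Pow {0..<m}" by blast
  define M where "M i j = (if j = n then v i else falling i j)" for i j
  have "rows_independent_on M (card \<alpha>) \<alpha>"
    if \<alpha>: "\<alpha> \<subseteq> {0..<m}" and good: "n \<notin> \<alpha> \<or> card \<alpha> - 1 \<notin> Q" for \<alpha>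
    unfolding rows_independent_on_def
  proof (intro allI impI)
    fix c :: "nat \<Rightarrow> 'a" and i
    assume 0: "\<forall>a\<in>\<alpha>. (\<Sum>i<card \<alpha>. c i * M i a) = 0" and i: "i < card \<alpha>"
    have fin: "finite \<alpha>" using \<alpha> finite_subset by blast
    define \<gamma> where "\<gamma> = \<alpha> - {n}"
    have fin': "finite \<gamma>" using fin by (simp add: \<gamma>_def)
    have zero: "(\<Sum>i<card \<alpha>. c i * falling i a) = 0" if "a \<in> \<gamma>" for a
      using that 0 by (auto simp: \<gamma>_def M_def)
    show "c i = 0"
    proof (cases "n \<in> \<alpha>")
      case False
      then have "\<gamma> = \<alpha>" by (simp add: \<gamma>_def)
      then show ?thesis
        using rows_independent_onD[OF rows_independent_on_falling[OF fin order_refl] _ i, of c] zero by blast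
    next
      case True
      define k where "k = card \<gamma>"
      have card: "card \<alpha> = Suc k"
        using True fin by (simp only: k_def \<gamma>_def card_Suc_Diff1)
      have kQ: "k \<notin> Q" using good True card by simp
      \<comment> \<open>If \<open>c k\<close> were nonzero, dividing by it would give the monic
        relation on \<gamma>, whose lower coefficients are \<open>g \<gamma>\<close>; the equation
        in column \<open>n\<close> would then make \<open>v k\<close> a forbidden value.\<close>
      have top: "c k = 0"
      proof (rule ccontr)
        assume ck: "c k \<noteq> 0"
        have "(\<Sum>i<Suc k. c i / c k * falling i a) = 0" if "a \<in> \<gamma>" for a
        proof -
          have "(\<Sum>i<Suc k. c i / c k * falling i a) = (\<Sum>i<Suc k. c i * falling i a) / c k"
            by (simp only: sum_divide_distrib times_divide_eq_left)
          then show ?thesis using zero[OF that] card by simp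
        qed
        then have "monic_zero \<gamma> (\<lambda>i. c i / c k)"
          using ck unfolding monic_zero_def k_def[symmetric] by auto
        then have g: "g \<gamma> l = c l / c k" if "l < k" for l
          using unique[OF fin'] that by (simp add: k_def)
        have "(\<Sum>l<k. c l * v l) + c k * v k = 0"
          using 0 True card by (auto simp: M_def)
        then have "v k = - ((\<Sum>l<k. c l * v l) / c k)"
          using ck by (simp add: field_simps eq_neg_iff_add_eq_0)
        also have "(\<Sum>l<k. c l * v l) / c k = (\<Sum>l<k. g \<gamma> l * v l)"
          unfolding sum_divide_distrib using g by (intro sum.cong) auto
        finally have "v k \<in> (\<lambda>\<gamma>. - (\<Sum>l<k. g \<gamma> l * v l)) ` Pow {0..<m}"
          using \<alpha> by (intro image_eqI[of _ _ \<gamma>]) (auto simp: \<gamma>_def)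
        then show False using v[of k] kQ by simp
      qed
      show ?thesis
      proof (cases "i = k")
        case False
        then have "i < k" using i card by simp
        \<comment> \<open>The top term is gone, leaving \<open>k\<close> rows of falling factorials
          on the \<open>k\<close> columns in \<gamma>.\<close>
        moreover have "(\<Sum>i<k. c i * falling i a) = 0" if "a \<in> \<gamma>" for a
          using zero[OF that] card top by simp
        ultimately show ?thesis
          using rows_independent_onD[OF rows_independent_on_falling[OF fin', of k], of c i]
          by (simp add: k_def)
      qed (use top in simp)
    qed
  qed
  moreover have "\<forall>i j. j < i \<longrightarrow> j \<noteq> n \<longrightarrow> M i j = 0" by (simp add: M_def falling_eq_0)
  moreover have "\<forall>i\<in>Q. M i n = 0" using v by (metis M_def)
  ultimately show ?thesis by blast
qed

section \<open>The matrix and its qpr-sequence\<close>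

lemma submatrix_mat_function:
  assumes "\<alpha> \<subseteq> {0..<m}" "\<beta> \<subseteq> {0..<m}"
  shows "submatrix (mat m m (\<lambda>(a, b). f a b)) \<alpha> \<beta> =
    mat (card \<alpha>) (card \<beta>) (\<lambda>(a, b). f (pick \<alpha> a) (pick \<beta> b))"
proof -
  have eq: "{i. i < m \<and> i \<in> \<alpha>} = \<alpha>" "{i. i < m \<and> i \<in> \<beta>} = \<beta>" using assms by auto
  have "pick \<alpha> a < m" if "a < card \<alpha>" for a using that by (intro pick_le) (simp add: eq)
  moreover have "pick \<beta> b < m" if "b < card \<beta>" for b using that by (intro pick_le) (simp add: eq)
  ultimately show ?thesis by (intro eq_matI) (auto simp: submatrix_def eq)
qed

lemma quasi_principal_atLeast0LessThan: "k \<le> m \<Longrightarrow> quasi_principal m {0..<k} {0..<k}"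
  by (simp add: quasi_principal_def)

theorem theorem3p6:
  fixes n t :: nat and q :: "qpr_letter list"
  assumes "n \<ge> 1" and "t \<ge> 1"
    and "length q = n" and "set q \<subseteq> {A, S}"
  shows "\<exists>B :: 'a::field_char_0 mat.
           B \<in> carrier_mat (n + t) (n + t) \<and> transpose_mat B = B \<and>
           qpr B = q @ replicate t N"
proof -
  define m where "m = n + t"
  \<comment> \<open>Rows count from 0: for \<open>1 \<le> k \<le> n\<close>, the \<open>k\<close>-th
    letter is \<open>S\<close> exactly when \<open>k - 1 \<in> Q\<close>.\<close>
  define Q where "Q = {i. i < n \<and> q ! i = S}"
  obtain M :: "nat \<Rightarrow> nat \<Rightarrow> 'a" where tri: "\<And>i j. j < i \<Longrightarrow> j \<noteq> n \<Longrightarrow> M i j = 0"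
    and col: "\<And>i. i \<in> Q \<Longrightarrow> M i n = 0"
    and ind: "\<And>\<alpha>. \<alpha> \<subseteq> {0..<m} \<Longrightarrow> n \<notin> \<alpha> \<or> card \<alpha> - 1 \<notin> Q \<Longrightarrow> rows_independent_on M (card \<alpha>) \<alpha>"
    using ex_triangular_array_prescribed_column[of n Q m] by metis
  obtain d where d: "\<And>\<alpha> \<beta>. card \<alpha> \<le> n \<Longrightarrow> \<alpha> \<subseteq> {0..<m} \<Longrightarrow> \<beta> \<subseteq> {0..<m} \<Longrightarrow> card \<beta> = card \<alpha> \<Longrightarrow>
      rows_independent_on M (card \<alpha>) \<alpha> \<Longrightarrow> rows_independent_on M (card \<alpha>) \<beta> \<Longrightarrow>
      det (mat (card \<alpha>) (card \<alpha>) (\<lambda>(a, b). \<Sum>i<n. d i * M i (pick \<alpha> a) * M i (pick \<beta> b))) \<noteq> 0"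
    using ex_weights_minors_nonzero[of n m M] by blast
  define B where "B = mat m m (\<lambda>(a, b). \<Sum>i<n. d i * M i a * M i b)"
  have dim: "dim_row B = m" by (simp add: B_def)
  have sub: "submatrix B \<alpha> \<beta> =
      mat (card \<alpha>) (card \<beta>) (\<lambda>(a, b). \<Sum>i<n. d i * M i (pick \<alpha> a) * M i (pick \<beta> b))"
    if "\<alpha> \<subseteq> {0..<m}" "\<beta> \<subseteq> {0..<m}" for \<alpha> \<beta>
    unfolding B_def by (rule submatrix_mat_function[OF that])
  have nonzero: "det (submatrix B \<alpha> \<beta>) \<noteq> 0"
    if "card \<alpha> \<le> n" "\<alpha> \<subseteq> {0..<m}" "\<beta> \<subseteq> {0..<m}" "card \<beta> = card \<alpha>"
      "n \<notin> \<alpha> \<or> card \<alpha> - 1 \<notin> Q" "n \<notin> \<beta> \<or> card \<alpha> - 1 \<notin> Q" for \<alpha> \<beta>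
    using d[OF that(1-4)] ind[of \<alpha>] ind[of \<beta>] that by (simp add: sub)
  \<comment> \<open>This also makes the set of minors nonempty, so that an order whose minors all
    vanish is not classified as \<open>A\<close> vacuously.\<close>
  have leading: "det (submatrix B {0..<k} {0..<k}) \<in> qp_minors B k" if "k \<le> m" for k
    using quasi_principal_atLeast0LessThan[OF that] unfolding qp_minors_def dim
    by (intro CollectI exI[of _ "{0..<k}"]) simp
  have entry_N: "qpr_entry B k = N" if k: "n < k" "k \<le> m" for k
  proof -
    have "x = 0" if minor: "x \<in> qp_minors B k" for x
    proof -
      obtain \<alpha> \<beta> where x: "x = det (submatrix B \<alpha> \<beta>)" and *: "quasi_principal m \<alpha> \<beta>" "card \<alpha> = k"
        using minor unfolding qp_minors_def dim by blast
      then show ?thesis using k by (auto simp: quasi_principal_def sub intro!: det_sum_rank_one_eq_0)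
    qed
    then show ?thesis using leading[OF k(2)] by (auto simp: qpr_entry_def)
  qed
  have entry_A: "qpr_entry B k = A" if k: "1 \<le> k" "k \<le> n" "k - 1 \<notin> Q" for k
  proof -
    have "x \<noteq> 0" if "x \<in> qp_minors B k" for x
      using that k nonzero unfolding qp_minors_def dim quasi_principal_def by fastforce
    then show ?thesis by (simp add: qpr_entry_def)
  qed
  have entry_S: "qpr_entry B k = S" if k: "1 \<le> k" "k \<le> n" "k - 1 \<in> Q" for k
  proof -
    \<comment> \<open>Exchanging the index \<open>k - 1\<close> for \<open>n\<close> leaves an
      overlap of \<open>k - 1\<close>, the least that is allowed; \<open>t \<ge> 1\<close> puts
      \<open>n\<close> below \<open>m\<close>.\<close>
    let ?\<alpha> = "{0..<k}" and ?\<beta> = "insert n {0..<k - 1}"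
    have s: "?\<alpha> \<subseteq> {0..<m}" "?\<beta> \<subseteq> {0..<m}" using k assms(2) by (auto simp: m_def)
    have c: "card ?\<alpha> = k" "card ?\<beta> = k" using k by auto
    have "?\<alpha> \<inter> ?\<beta> = {0..<k - 1}" using k by auto
    then have qp: "quasi_principal m ?\<alpha> ?\<beta>" using s c by (simp add: quasi_principal_def)
    have "det (submatrix B ?\<alpha> ?\<beta>) = 0"
    proof -
      \<comment> \<open>Only \<open>k - 1\<close> summands can survive here. For
        \<open>i \<ge> k\<close>, \<open>M i a = 0\<close> since \<open>a < k\<close>. For
        \<open>i = k - 1\<close>, either \<open>b < i\<close>, or \<open>b = n\<close> and
        \<open>M i n = 0\<close> because \<open>i \<in> Q\<close>.\<close>
      have "(\<Sum>i<n. d i * M i a * M i b) = (\<Sum>i<k - 1. d i * M i a * M i b)"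
        if a: "a \<in> ?\<alpha>" and b: "b \<in> ?\<beta>" for a b
      proof (rule sum.mono_neutral_right)
        show "\<forall>i\<in>{..<n} - {..<k - 1}. d i * M i a * M i b = 0"
        proof
          fix i assume "i \<in> {..<n} - {..<k - 1}"
          then consider "i \<ge> k" | "i = k - 1" by force
          then show "d i * M i a * M i b = 0"
          proof cases
            case 1
            then show ?thesis using tri[of a i] a k by simp
          next
            case 2
            then show ?thesis using tri[of b i] col[of i] b k by auto
          qed
        qed
      qed (use k in auto)
      moreover have "pick ?\<alpha> a \<in> ?\<alpha>" if "a < k" for a using that by (intro pick_in_set_le) simp
      moreover have "pick ?\<beta> b \<in> ?\<beta>" if "b < k" for b using that c(2) by (intro pick_in_set_le) simp
      ultimately have "submatrix B ?\<alpha> ?\<beta> =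
          mat k k (\<lambda>(a, b). \<Sum>i<k - 1. d i * M i (pick ?\<alpha> a) * M i (pick ?\<beta> b))"
        unfolding sub[OF s] c by (intro eq_matI) auto
      then show ?thesis using k det_sum_rank_one_eq_0[of "k - 1" k] by simp
    qed
    then have "0 \<in> qp_minors B k" using qp c(1) unfolding qp_minors_def dim by force
    \<comment> \<open>As \<open>k \<le> n\<close>, the leading principal minor avoids the index
      \<open>n\<close>, so it is nonzero even when the letter is \<open>S\<close>.\<close>
    moreover have "det (submatrix B ?\<alpha> ?\<alpha>) \<noteq> 0" using k s by (intro nonzero) auto
    moreover have "det (submatrix B ?\<alpha> ?\<alpha>) \<in> qp_minors B k" using k by (intro leading) (simp add: m_def)
    ultimately show ?thesis by (auto simp: qpr_entry_def)
  qed
  have "qpr B = q @ replicate t N"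
  proof (rule nth_equalityI)
    show "length (qpr B) = length (q @ replicate t N)"
      using assms(1,3) by (simp add: qpr_def dim m_def)
    fix i assume "i < length (qpr B)"
    then have i: "i < m" by (simp add: qpr_def dim del: upt_Suc)
    then have entry: "qpr B ! i = qpr_entry B (Suc i)"
      by (simp add: qpr_def dim del: upt_Suc)
    show "qpr B ! i = (q @ replicate t N) ! i"
    proof (cases "i < n")
      case True
      then have "q ! i = A \<or> q ! i = S" using assms(3,4) nth_mem by blast
      then show ?thesis
        using True entry entry_A[of "Suc i"] entry_S[of "Suc i"] assms(3)
        by (auto simp: Q_def nth_append)
    next
      case False
      then show ?thesis using i entry entry_N[of "Suc i"] assms(3) by (simp add: nth_append m_def)
    qed
  qed
  moreover have "transpose_mat B = B"
    by (intro eq_matI) (auto simp: B_def mult_ac)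
  moreover have "B \<in> carrier_mat (n + t) (n + t)" by (simp add: B_def m_def)
  ultimately show ?thesis by blast
qed

end
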